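(* Let $q$ be a prime power and $n$ a positive integer. The characteristic polynomial of the matroid dual to $PG(n-1,q)$ satisfies $$\chi_{PG(n-1,q)^*}(x)=\frac{(-1)^{\frac{q^n-1}{q-1}}}{x^n}\sum_{k=0}^n\binom{n}{k}_q(1-x)^{\frac{q^k-1}{q-1}}\prod_{i=0}^{n-k-1}(x-q^i),$$ where the empty product (for $k=n$) equals $1$.
   Context: $PG(n-1,q)$ denotes the matroid whose ground set $E$ is the set of all points of the $(n-1)$-dimensional projective space over the finite field $\mathbb{F}_q$ (i.e. the one-dimensional subspaces of $\mathbb{F}_q^n$), the rank $r(A)$ of $A\subseteq E$ being the dimension of the linear subspace of $\mathbb{F}_q^n$ spanned by $A$. The Gaussian binomial coefficient is $$\binom{n}{k}_q=\frac{(q^n-1)(q^{n-1}-1)\cdots(q^{n-k+1}-1)}{(q^k-1)(q^{k-1}-1)\cdots(q-1)}.$$ The dual $M^*=(E,r^* )$ of a matroid $M=(E,r)$ has rank function $r^*(A)=r(E-A)+|A|-r(E)$, and the characteristic polynomial of a matroid $M=(E,r)$ is $\chi_M(x)=\sum_{A\subseteq E}(-1)^{|A|}x^{r(E)-r(A)}$. *)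

theory Defs
  imports
    "HOL-Analysis.Cartesian_Space"
    "HOL-Computational_Algebra.Polynomial_Factorial"
begin

text \<open>
  A matroid \<open>(E, r)\<close> is given by its ground set and its rank function. Only the values of
  the rank function on subsets of the ground set are meaningful.
\<close>

record 'e matroid =
  ground :: "'e set"
  rk :: "'e set \<Rightarrow> nat"

definition is_matroid :: "'e matroid \<Rightarrow> bool" where
  "is_matroid M \<longleftrightarrow> finite (ground M) \<and>
     (\<forall>A. A \<subseteq> ground M \<longrightarrow> rk M A \<le> card A) \<and>
     (\<forall>A B. A \<subseteq> B \<longrightarrow> B \<subseteq> ground M \<longrightarrow> rk M A \<le> rk M B) \<and>
     (\<forall>A B. A \<subseteq> ground M \<longrightarrow> B \<subseteq> ground M \<longrightarrow>
        rk M (A \<union> B) + rk M (A \<inter> B) \<le> rk M A + rk M B)"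

text \<open>
  The truncated subtractions below are exact on matroids: see \<open>rk_le_rk_compl_plus_card\<close>
  for the dual and monotonicity of the rank for the characteristic polynomial.
\<close>

definition dual :: "'e matroid \<Rightarrow> 'e matroid" where
  "dual M = \<lparr>ground = ground M,
             rk = (\<lambda>A. rk M (ground M - A) + card A - rk M (ground M))\<rparr>"

definition characteristic_poly :: "'e matroid \<Rightarrow> int poly" where
  "characteristic_poly M =
     (\<Sum>A\<in>Pow (ground M). monom ((-1) ^ card A) (rk M (ground M) - rk M A))"

text \<open>
  The matroid \<open>PG(n-1,q)\<close>, where \<open>q = CARD('a)\<close> and \<open>n = CARD('n)\<close>. Its elements are
  one-dimensional subspaces, so a set \<open>A\<close> of elements spans the subspace \<open>vec.span (\<Union>A)\<close>.
\<close>

definition PG :: "('a::{field,finite} ^ 'n) set matroid" where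
  "PG = \<lparr>ground = {L. vec.subspace L \<and> vec.dim L = 1},
         rk = (\<lambda>A. vec.dim (vec.span (\<Union>A)))\<rparr>"

text \<open>Intended for \<open>q > 1\<close> and \<open>k \<le> n\<close>.\<close>

definition gauss_binomial :: "nat \<Rightarrow> nat \<Rightarrow> nat \<Rightarrow> 'b::field_char_0" where
  "gauss_binomial q n k =
     (\<Prod>i<k. of_nat q ^ (n - i) - 1) / (\<Prod>i<k. of_nat q ^ (k - i) - 1)"

lemma rk_le_rk_compl_plus_card:
  assumes "is_matroid M" "A \<subseteq> ground M"
  shows "rk M (ground M) \<le> rk M (ground M - A) + card A"
proof -
  note axs = assms(1)[unfolded is_matroid_def]
  have "rk M ((ground M - A) \<union> A) + rk M ((ground M - A) \<inter> A) \<le> rk M (ground M - A) + rk M A"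
    using axs[THEN conjunct2, THEN conjunct2, THEN conjunct2] Diff_subset assms(2) by iprover
  moreover have "(ground M - A) \<union> A = ground M"
    using assms(2) by blast
  moreover have "rk M A \<le> card A"
    using axs[THEN conjunct2, THEN conjunct1] assms(2) by iprover
  ultimately show ?thesis
    by simp
qed

lemma rk_dual:
  assumes "is_matroid M" "A \<subseteq> ground M"
  shows "rk (dual M) A + rk M (ground M) = rk M (ground M - A) + card A"
  using rk_le_rk_compl_plus_card[OF assms] by (simp add: dual_def)

lemma is_matroid_dual:
  assumes "is_matroid M"
  shows "is_matroid (dual M)"
proof -
  let ?E = "ground M"
  note axs = assms[unfolded is_matroid_def]
  have fin: "finite ?E"
    using axs by (rule conjunct1)
  have card: "rk M A \<le> card A" if "A \<subseteq> ?E" for A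
    using axs[THEN conjunct2, THEN conjunct1] that by iprover
  have mono: "rk M A \<le> rk M B" if "A \<subseteq> B" "B \<subseteq> ?E" for A B
    using axs[THEN conjunct2, THEN conjunct2, THEN conjunct1] that by iprover
  have submod: "rk M (A \<union> B) + rk M (A \<inter> B) \<le> rk M A + rk M B"
    if "A \<subseteq> ?E" "B \<subseteq> ?E" for A B
    using axs[THEN conjunct2, THEN conjunct2, THEN conjunct2] that by iprover
  note rk_dual = rk_dual[OF assms]
  have le_card': "rk (dual M) A \<le> card A" if "A \<subseteq> ?E" for A
    using mono[OF Diff_subset subset_refl, of A] rk_dual[OF that] by linarith
  have mono': "rk (dual M) A \<le> rk (dual M) B" if AB: "A \<subseteq> B" "B \<subseteq> ?E" for A B
  proof -
    have eq: "(?E - B) \<union> (B - A) = ?E - A"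
      using AB by blast
    have BA: "B - A \<subseteq> ?E" "A \<subseteq> ?E"
      using AB by blast+
    have "rk M (?E - A) \<le> rk M (?E - B) + rk M (B - A)"
      using submod[OF Diff_subset BA(1), of B] unfolding eq by linarith
    moreover have "finite B"
      using AB(2) fin by (rule finite_subset)
    then have "card (B - A) = card B - card A" "card A \<le> card B"
      using AB(1) by (metis card_Diff_subset finite_subset, metis card_mono)
    ultimately show ?thesis
      using card[OF BA(1)] rk_dual[OF BA(2)] rk_dual[OF AB(2)] by linarith
  qed
  have submod': "rk (dual M) (A \<union> B) + rk (dual M) (A \<inter> B)
      \<le> rk (dual M) A + rk (dual M) B" if AB: "A \<subseteq> ?E" "B \<subseteq> ?E" for A B
  proof -
    have "rk M (?E - (A \<inter> B)) + rk M (?E - (A \<union> B)) \<le> rk M (?E - A) + rk M (?E - B)"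
      using submod[OF Diff_subset Diff_subset, of A B] unfolding Diff_Int Diff_Un .
    moreover have "card A + card B = card (A \<union> B) + card (A \<inter> B)"
      by (rule card_Un_Int) (rule finite_subset[OF AB(1) fin], rule finite_subset[OF AB(2) fin])
    moreover have "A \<union> B \<subseteq> ?E" "A \<inter> B \<subseteq> ?E"
      using AB by blast+
    ultimately show ?thesis
      using rk_dual[of A] rk_dual[of B] rk_dual[of "A \<union> B"] rk_dual[of "A \<inter> B"] AB by linarith
  qed
  have "ground (dual M) = ?E"
    by (simp add: dual_def)
  then show ?thesis
    unfolding is_matroid_def by (intro conjI allI impI) (simp_all only: fin le_card' mono' submod')
qed

lemma is_matroid_PG: "is_matroid (PG :: ('a::{field,finite} ^ 'n) set matroid)"
proof -
  let ?M = "PG :: ('a ^ 'n) set matroid"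
  have mono: "rk ?M A \<le> rk ?M B" if "A \<subseteq> B" for A B
    unfolding PG_def using that by (simp add: Union_mono vec.dim_subset)
  have submod: "rk ?M (A \<union> B) + rk ?M (A \<inter> B) \<le> rk ?M A + rk ?M B" for A B
  proof -
    let ?S = "vec.span (\<Union>A)" and ?T = "vec.span (\<Union>B)"
    have "vec.dim {x + y |x y. x \<in> ?S \<and> y \<in> ?T} + vec.dim (?S \<inter> ?T) = vec.dim ?S + vec.dim ?T"
      by (rule vec.dim_sums_Int) auto
    moreover have "vec.dim {x + y |x y. x \<in> ?S \<and> y \<in> ?T} = vec.dim (vec.span (\<Union>(A \<union> B)))"
      by (rule arg_cong[where f = vec.dim], unfold Union_Un_distrib vec.span_Un) auto
    moreover have "vec.dim (vec.span (\<Union>(A \<inter> B))) \<le> vec.dim (?S \<inter> ?T)"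
    proof (rule vec.dim_subset)
      show "vec.span (\<Union>(A \<inter> B)) \<subseteq> ?S \<inter> ?T"
        by (rule Int_greatest; rule vec.span_mono; blast)
    qed
    ultimately have "vec.dim (vec.span (\<Union>(A \<union> B))) + vec.dim (vec.span (\<Union>(A \<inter> B)))
        \<le> vec.dim ?S + vec.dim ?T"
      by linarith
    then show ?thesis
      unfolding PG_def matroid.simps .
  qed
  have le_card: "rk ?M A \<le> card A" if A: "A \<subseteq> ground ?M" for A
  proof -
    have "\<exists>v. L \<subseteq> vec.span {v}" if "L \<in> A" for L
    proof -
      have "vec.dim L = 1"
        using subsetD[OF A that] by (simp add: PG_def)
      moreover obtain B where B: "B \<subseteq> L" "vec.independent B" "L \<subseteq> vec.span B" "card B = vec.dim L"
        by (rule vec.basis_exists)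
      ultimately obtain v where "B = {v}"
        using card_1_singletonE[of B] by auto
      with B show ?thesis
        by blast
    qed
    then obtain f where f: "\<And>L. L \<in> A \<Longrightarrow> L \<subseteq> vec.span {f L}"
      using bchoice[of A "\<lambda>L v. L \<subseteq> vec.span {v}"] by blast
    have "\<Union>A \<subseteq> vec.span (f ` A)"
    proof
      fix x assume "x \<in> \<Union>A"
      then obtain L where "L \<in> A" "x \<in> L" by blast
      moreover have "vec.span {f L} \<subseteq> vec.span (f ` A)"
        using \<open>L \<in> A\<close> by (intro vec.span_mono) simp
      ultimately show "x \<in> vec.span (f ` A)"
        using f[of L] by blast
    qed
    then have "vec.dim (\<Union>A) \<le> card (f ` A)"
      by (rule vec.dim_le_card) simp
    also have "\<dots> \<le> card A"
      by (rule card_image_le) simp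
    finally show ?thesis
      unfolding PG_def by simp
  qed
  show ?thesis
    unfolding is_matroid_def
    by (intro conjI allI impI) (simp_all only: finite le_card mono submod)
qed

end

theory Submission
  imports Defs
begin

text \<open>
  Since \<open>r\<^sup>*(E) - r\<^sup>*(E - B) = |B| - r(B)\<close>, the characteristic polynomial of the dual is
  \<open>(-1)\<^bsup>|E|\<^esup> x\<^bsup>-n\<^esup> \<Sum>\<^sub>B (-x)\<^bsup>|B|\<^esup> x\<^bsup>n - r(B)\<^esup>\<close>. The \<open>q\<close>-analogue of the binomial theorem gives
  \<open>x\<^bsup>n - dim U\<^esup> = \<Sum>\<^sub>W p\<^sub>W(x)\<close>, where \<open>W\<close> ranges over the subspaces containing \<open>U\<close>, and
  \<open>p\<^sub>W(x)\<close> is the product of the factors \<open>x - q\<^sup>i\<close> with \<open>i < n - dim W\<close>. Substituting this with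
  \<open>U\<close> the span of \<open>B\<close> and exchanging the sums leaves, for each \<open>W\<close>, the sum of
  \<open>(-x)\<^bsup>|B|\<^esup>\<close> over all sets \<open>B\<close> of points of \<open>W\<close>, which is a power of \<open>1 - x\<close>.
\<close>

section \<open>Gaussian binomial coefficients\<close>

lemma of_nat_power_minus_1_neq_0:
  assumes "q > 1" "k > 0"
  shows "(of_nat q ^ k - 1 :: 'b::field_char_0) \<noteq> 0"
proof -
  have "q ^ k \<noteq> 1"
    using assms by (metis less_irrefl one_less_power)
  then have "(of_nat (q ^ k) :: 'b) \<noteq> of_nat 1"
    unfolding of_nat_eq_iff .
  then show ?thesis
    by simp
qed

lemma gauss_binomial_0_right [simp]: "gauss_binomial q n 0 = 1"
  by (simp add: gauss_binomial_def)

text \<open>The numerator contains the factor for \<open>i = n\<close>, which is q^0 - 1 =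
  0.\<close>

lemma gauss_binomial_eq_0: "n < k \<Longrightarrow> gauss_binomial q n k = 0"
  unfolding gauss_binomial_def by (auto simp: prod_zero_iff intro!: bexI[of _ n])

lemma gauss_binomial_Suc_right:
  "gauss_binomial q n (Suc k) =
    (gauss_binomial q n k * (of_nat q ^ (n - k) - 1) / (of_nat q ^ Suc k - 1) :: 'b::field_char_0)"
  unfolding gauss_binomial_def
  \<comment> \<open>The numerator gains a last factor, the denominator a first one; hence only the
    denominator is split at \<open>i = 0\<close>.\<close>
  by (subst (2) prod.lessThan_Suc_shift) (simp add: mult_ac)

lemma gauss_binomial_Suc_Suc:
  "gauss_binomial q (Suc n) (Suc k) =
    (gauss_binomial q n k * (of_nat q ^ Suc n - 1) / (of_nat q ^ Suc k - 1) :: 'b::field_char_0)"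
  unfolding gauss_binomial_def
  by (subst (1 2) prod.lessThan_Suc_shift) (simp add: mult_ac)

text \<open>With the other two coefficients written as multiples of
  \<open>gauss_binomial q n k\<close>, this reduces to q^(n+1) - 1 = (q^(n-k) - 1) + q^(n-k)
  (q^(k+1) - 1).\<close>

lemma gauss_binomial_pascal:
  assumes "q > 1" "k \<le> n"
  shows "gauss_binomial q (Suc n) (Suc k) =
    gauss_binomial q n (Suc k) + of_nat q ^ (n - k) * (gauss_binomial q n k :: 'b::field_char_0)"
proof -
  let ?Q = "of_nat q :: 'b"
  have "?Q ^ Suc k - 1 \<noteq> 0"
    using assms(1) by (rule of_nat_power_minus_1_neq_0) simp
  moreover have "?Q ^ Suc n = ?Q ^ (n - k) * ?Q ^ Suc k"
    using assms(2) by (simp flip: power_add)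
  ultimately show ?thesis
    unfolding gauss_binomial_Suc_Suc gauss_binomial_Suc_right[of q n k]
    by (simp only: add_divide_eq_iff divide_add_eq_iff frac_eq_eq) (simp add: field_simps)
qed

text \<open>Induction by the Pascal rule: its weight q^(n-k) cancels the constant term of the new
  factor X - q^(n-k), so that a factor X remains.\<close>

lemma gauss_binomial_cauchy:
  fixes X :: "'b::field_char_0"
  assumes "q > 1"
  shows "(\<Sum>k\<le>n. gauss_binomial q n k * (\<Prod>i<n - k. X - of_nat q ^ i)) = X ^ n"
proof (induction n)
  case 0
  show ?case by simp
next
  case (Suc n)
  define p where "p j = (\<Prod>i<j. X - of_nat q ^ i)" for j
  define g where "g k = (gauss_binomial q n k :: 'b)" for k
  have "(\<Sum>k\<le>Suc n. gauss_binomial q (Suc n) k * p (Suc n - k)) =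
      p (Suc n) + (\<Sum>k\<le>n. (g (Suc k) + of_nat q ^ (n - k) * g k) * p (n - k))"
    using assms by (subst sum.atMost_Suc_shift) (simp add: gauss_binomial_pascal g_def)
  also have "\<dots> = (p (Suc n) + (\<Sum>k\<le>n. g (Suc k) * p (n - k))) +
      (\<Sum>k\<le>n. of_nat q ^ (n - k) * g k * p (n - k))"
    by (simp add: ring_distribs sum.distrib)
  also have "p (Suc n) + (\<Sum>k\<le>n. g (Suc k) * p (n - k)) = (\<Sum>k\<le>Suc n. g k * p (Suc n - k))"
    by (subst sum.atMost_Suc_shift) (simp add: g_def)
  \<comment> \<open>The term \<open>k = Suc n\<close> vanishes, since
    \<open>g (Suc n) = 0\<close>.\<close>
  also have "\<dots> = (\<Sum>k\<le>n. g k * p (Suc n - k))"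
    by (simp add: g_def gauss_binomial_eq_0)
  also have "\<dots> = (\<Sum>k\<le>n. g k * (p (n - k) * (X - of_nat q ^ (n - k))))"
    by (rule sum.cong) (auto simp: p_def Suc_diff_le)
  also have "\<dots> + (\<Sum>k\<le>n. of_nat q ^ (n - k) * g k * p (n - k)) =
      X * (\<Sum>k\<le>n. g k * p (n - k))"
    unfolding sum.distrib[symmetric] sum_distrib_left
    by (rule sum.cong) (auto simp: algebra_simps)
  also have "(\<Sum>k\<le>n. g k * p (n - k)) = X ^ n"
    using Suc.IH by (simp add: p_def g_def)
  finally show ?case
    by (simp add: p_def)
qed

section \<open>Counting subspaces\<close>

lemma card_field_gt_1: "CARD('a::{field,finite}) > 1"
  using card_mono[of "UNIV :: 'a set" "{0, 1}"] by simp

text \<open>Each vector of the larger span is c v + w with w in the smaller one, for exactly one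
  pair (c, w).\<close>

lemma card_span_insert:
  fixes v :: "'a::{field,finite} ^ 'n"
  assumes "v \<notin> vec.span S"
  shows "card (vec.span (insert v S)) = CARD('a) * card (vec.span S)"
proof -
  let ?f = "\<lambda>(c, w). c *s v + w"
  have "inj_on ?f (UNIV \<times> vec.span S)"
  proof (rule inj_onI, clarify)
    fix c w d z
    assume w: "w \<in> vec.span S" and z: "z \<in> vec.span S" and eq: "c *s v + w = d *s v + z"
    have *: "(c - d) *s v = z - w"
      using eq by (simp add: vec.scale_left_diff_distrib algebra_simps)
    have "c = d"
    proof (rule ccontr)
      assume "c \<noteq> d"
      then have "v = inverse (c - d) *s (z - w)"
        unfolding *[symmetric] by simp
      then show False
        using assms w z by (metis vec.span_diff vec.span_scale)
    qed
    then show "c = d \<and> w = z"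
      using eq by simp
  qed
  moreover have "?f ` (UNIV \<times> vec.span S) = vec.span (insert v S)"
  proof (intro equalityI subsetI)
    fix x assume "x \<in> vec.span (insert v S)"
    then obtain c where "x - c *s v \<in> vec.span S"
      unfolding vec.span_insert by blast
    then show "x \<in> ?f ` (UNIV \<times> vec.span S)"
      by (intro image_eqI[where x = "(c, x - c *s v)"]) auto
  next
    fix x assume "x \<in> ?f ` (UNIV \<times> vec.span S)"
    then obtain c w where "x = c *s v + w" "w \<in> vec.span S"
      by auto
    moreover have "vec.span S \<subseteq> vec.span (insert v S)"
      by (rule vec.span_mono) blast
    ultimately show "x \<in> vec.span (insert v S)"
      by (auto intro: vec.span_add vec.span_scale vec.span_base)
  qed
  ultimately show ?thesis
    by (metis card_cartesian_product card_image)
qed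

lemma card_subspace:
  fixes W :: "('a::{field,finite} ^ 'n) set"
  assumes "vec.subspace W"
  shows "card W = CARD('a) ^ vec.dim W"
proof -
  obtain B where B: "B \<subseteq> W" "vec.independent B" "W \<subseteq> vec.span B" "card B = vec.dim W"
    by (rule vec.basis_exists)
  have "card (vec.span B) = CARD('a) ^ card B"
    using finite[of B] B(2)
  proof (induction B rule: finite_induct)
    case empty
    show ?case by simp
  next
    case (insert v B)
    then show ?case
      by (simp add: vec.independent_insert card_span_insert)
  qed
  moreover have "vec.span B = W"
    using B(1,3) assms by (metis subset_antisym vec.span_minimal)
  ultimately show ?thesis
    using B(4) by simp
qed

lemma dim_span_insert:
  fixes U :: "('a::field ^ 'n) set"
  assumes "vec.subspace U" "v \<notin> U"
  shows "vec.dim (vec.span (insert v U)) = Suc (vec.dim U)"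
proof -
  have "vec.span U = U"
    using assms(1) by simp
  with assms(2) show ?thesis
    by (simp only: vec.dim_span vec.dim_insert if_False Suc_eq_plus1)
qed

text \<open>These stand for the \<open>d\<close>-dimensional subspaces of the quotient of
  \<open>V\<close> by \<open>U\<close>, represented by their preimages in \<open>V\<close>.\<close>

definition intermediate_subspaces ::
    "('a::{field,finite} ^ 'n) set \<Rightarrow> ('a ^ 'n) set \<Rightarrow> nat \<Rightarrow> ('a ^ 'n) set set" where
  "intermediate_subspaces U V d =
     {W. vec.subspace W \<and> U \<subseteq> W \<and> W \<subseteq> V \<and> vec.dim W = vec.dim U + d}"

text \<open>Double counting of the pairs \<open>(v, W)\<close> with \<open>v \<in> W - U\<close>.\<close>

lemma card_intermediate_subspaces_step:
  fixes U V :: "('a::{field,finite} ^ 'n) set"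
  assumes U: "vec.subspace U" and V: "vec.subspace V" and UV: "U \<subseteq> V"
    and N: "\<And>v. v \<in> V - U \<Longrightarrow> card (intermediate_subspaces (vec.span (insert v U)) V d) = N"
  shows "card (intermediate_subspaces U V (Suc d)) *
           (CARD('a) ^ (vec.dim U + Suc d) - CARD('a) ^ vec.dim U) =
         (CARD('a) ^ vec.dim V - CARD('a) ^ vec.dim U) * N"
proof -
  let ?I = "intermediate_subspaces U V (Suc d)"
  have "(\<Sum>W\<in>?I. card {v \<in> V - U. v \<in> W}) = (\<Sum>v\<in>V - U. N)"
  proof (rule sum_multicount_gen)
    show "\<forall>v\<in>V - U. card {W \<in> ?I. v \<in> W} = N"
    proof
      fix v assume v: "v \<in> V - U"
      have "vec.dim (vec.span (insert v U)) = Suc (vec.dim U)"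
        using U v by (simp only: dim_span_insert Diff_iff not_False_eq_True)
      \<comment> \<open>The \<open>W\<close> through \<open>v\<close> are those above the span of
        \<open>insert v U\<close>. This span has one dimension more than \<open>U\<close>, so
        \<open>Suc d\<close> drops to \<open>d\<close>.\<close>
      moreover have "vec.span (insert v U) \<subseteq> W \<longleftrightarrow> insert v U \<subseteq> W" if "vec.subspace W" for W
        using that by (meson order_trans vec.span_minimal vec.span_superset)
      ultimately have "{W \<in> ?I. v \<in> W} = intermediate_subspaces (vec.span (insert v U)) V d"
        unfolding intermediate_subspaces_def by auto
      then show "card {W \<in> ?I. v \<in> W} = N"
        using N[OF v] by simp
    qed
  qed auto
  moreover have "card {v \<in> V - U. v \<in> W} = CARD('a) ^ (vec.dim U + Suc d) - CARD('a) ^ vec.dim U"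
    if "W \<in> ?I" for W
  proof -
    have W: "vec.subspace W" "U \<subseteq> W" "W \<subseteq> V" "vec.dim W = vec.dim U + Suc d"
      using that by (auto simp: intermediate_subspaces_def)
    then have "{v \<in> V - U. v \<in> W} = W - U"
      by auto
    then show ?thesis
      using W U by (simp add: card_Diff_subset card_subspace del: power_Suc)
  qed
  moreover have "card (V - U) = CARD('a) ^ vec.dim V - CARD('a) ^ vec.dim U"
    using U V UV by (simp add: card_Diff_subset card_subspace)
  ultimately show ?thesis
    by simp
qed

text \<open>Induction on \<open>d\<close> for all \<open>U\<close>: double counting reduces
  \<open>Suc d\<close> over \<open>U\<close> to \<open>d\<close> over \<open>U\<close> enlarged by a
  vector, and its ratio is that of \<open>gauss_binomial_Suc_Suc\<close>.\<close>

lemma card_intermediate_subspaces: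
  fixes U V :: "('a::{field,finite} ^ 'n) set"
  assumes "vec.subspace U" "vec.subspace V" "U \<subseteq> V"
  shows "of_nat (card (intermediate_subspaces U V d)) =
    (gauss_binomial CARD('a) (vec.dim V - vec.dim U) d :: 'b::field_char_0)"
  using assms
proof (induction d arbitrary: U)
  case 0
  have "intermediate_subspaces U V 0 = {U}"
    unfolding intermediate_subspaces_def
    using 0 vec.subspace_dim_equal[of U] by fastforce
  then show ?case
    by simp
next
  case (Suc d)
  note U = Suc.prems(1) and V = Suc.prems(2) and UV = Suc.prems(3)
  let ?q = "CARD('a)" and ?Q = "of_nat CARD('a) :: 'b"
  let ?u = "vec.dim U" and ?v = "vec.dim V"
  show ?case
  \<comment> \<open>If \<open>U = V\<close>, there is no vector to adjoin, and both sides are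
    0.\<close>
  proof (cases "U = V")
    case True
    have "intermediate_subspaces U V (Suc d) = {}"
      unfolding intermediate_subspaces_def True using vec.dim_subset by fastforce
    then show ?thesis
      using True by (simp add: gauss_binomial_eq_0)
  next
    case False
    have "?u \<noteq> ?v"
      using False vec.subspace_dim_equal[OF U V UV] by auto
    then have lt: "?u < ?v"
      using vec.dim_subset[OF UV] by simp
    \<comment> \<open>\<open>m\<close> is the codimension in \<open>V\<close> of \<open>U\<close>
      enlarged by one vector.\<close>
    obtain m where m: "?v = ?u + Suc m"
      using lt less_iff_Suc_add by auto
    have IH: "of_nat (card (intermediate_subspaces (vec.span (insert v U)) V d)) =
        (gauss_binomial ?q m d :: 'b)" if "v \<in> V - U" for v
    proof -
      have "vec.dim (vec.span (insert v U)) = Suc ?u"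
        using that U by (simp only: dim_span_insert Diff_iff not_False_eq_True)
      moreover have "vec.span (insert v U) \<subseteq> V"
        using that UV V by (intro vec.span_minimal) auto
      ultimately show ?thesis
        using Suc.IH[of "vec.span (insert v U)"] V m by simp
    qed
    obtain v where v: "v \<in> V - U"
      using False UV by blast
    define N where "N = card (intermediate_subspaces (vec.span (insert v U)) V d)"
    have N: "of_nat N = (gauss_binomial ?q m d :: 'b)"
      using IH[OF v] by (simp add: N_def)
    \<comment> \<open>The induction hypothesis only gives images in \<open>'b\<close>;
      characteristic 0 makes the natural numbers themselves equal.\<close>
    have "card (intermediate_subspaces (vec.span (insert w U)) V d) = N" if "w \<in> V - U" for w
      using IH[OF that] N by (metis of_nat_eq_iff)
    then have "card (intermediate_subspaces U V (Suc d)) * (?q ^ (?u + Suc d) - ?q ^ ?u) =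
        (?q ^ (?u + Suc m) - ?q ^ ?u) * N"
      unfolding m[symmetric] by (rule card_intermediate_subspaces_step[OF U V UV])
    then have "?q ^ ?u * (card (intermediate_subspaces U V (Suc d)) * (?q ^ Suc d - 1)) =
        ?q ^ ?u * ((?q ^ Suc m - 1) * N)"
      by (simp add: power_add algebra_simps diff_mult_distrib2)
    then have "card (intermediate_subspaces U V (Suc d)) * (?q ^ Suc d - 1) = (?q ^ Suc m - 1) * N"
      using card_field_gt_1[where 'a = 'a] by simp
    then have "(of_nat (card (intermediate_subspaces U V (Suc d)) * (?q ^ Suc d - 1)) :: 'b) =
        of_nat ((?q ^ Suc m - 1) * N)"
      by (rule arg_cong)
    then have "of_nat (card (intermediate_subspaces U V (Suc d))) * (?Q ^ Suc d - 1) =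
        (?Q ^ Suc m - 1) * gauss_binomial ?q m d"
      using card_field_gt_1[where 'a = 'a] by (simp add: N of_nat_diff del: power_Suc)
    moreover have "?Q ^ Suc d - 1 \<noteq> 0"
      using card_field_gt_1 by (rule of_nat_power_minus_1_neq_0) simp
    ultimately show ?thesis
      unfolding m by (simp add: gauss_binomial_Suc_Suc eq_divide_eq mult.commute del: power_Suc)
  qed
qed

text \<open>The subspaces are grouped by \<open>d\<close>, their dimension over \<open>U\<close>;
  each group is counted by \<open>card_intermediate_subspaces\<close> with
  \<open>V = UNIV\<close>.\<close>

lemma sum_subspaces_containing:
  fixes U :: "('a::{field,finite} ^ 'n) set" and f :: "nat \<Rightarrow> 'b::field_char_0"
  assumes U: "vec.subspace U"
  shows "(\<Sum>W | vec.subspace W \<and> U \<subseteq> W. f (vec.dim W)) =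
    (\<Sum>d\<le>CARD('n) - vec.dim U. gauss_binomial CARD('a) (CARD('n) - vec.dim U) d * f (vec.dim U + d))"
proof -
  let ?S = "{W. vec.subspace W \<and> U \<subseteq> W}" and ?u = "vec.dim U"
  have dim: "?u \<le> vec.dim W" "vec.dim W \<le> CARD('n)" if "W \<in> ?S" for W
    using that dim_subset_UNIV_cart_gen[of W] by (auto intro: vec.dim_subset)
  have "(\<Sum>W\<in>?S. f (vec.dim W)) =
      (\<Sum>d\<le>CARD('n) - ?u. \<Sum>W | W \<in> ?S \<and> vec.dim W - ?u = d. f (vec.dim W))"
    using dim by (intro sum.group[symmetric]) (auto intro: diff_le_mono)
  also have "\<dots> = (\<Sum>d\<le>CARD('n) - ?u. \<Sum>W\<in>intermediate_subspaces U UNIV d. f (?u + d))"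
    using dim by (intro sum.cong) (fastforce simp: intermediate_subspaces_def)+
  also have "\<dots> = (\<Sum>d\<le>CARD('n) - ?u. gauss_binomial CARD('a) (CARD('n) - ?u) d * f (?u + d))"
    using card_intermediate_subspaces[OF U vec.subspace_UNIV, where 'b = 'b]
    by (simp add: vec_dim_card del: vec.dim_UNIV)
  finally show ?thesis .
qed

text \<open>This is \<open>gauss_binomial_cauchy\<close> for the codimension of \<open>U\<close>,
  with each coefficient read as a number of subspaces.\<close>

lemma power_codim_eq_sum_subspaces:
  fixes U :: "('a::{field,finite} ^ 'n) set" and X :: "'b::field_char_0"
  assumes "vec.subspace U"
  shows "X ^ (CARD('n) - vec.dim U) =
    (\<Sum>W | vec.subspace W \<and> U \<subseteq> W. \<Prod>i<CARD('n) - vec.dim W. X - of_nat CARD('a) ^ i)"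
  using sum_subspaces_containing[OF assms, of "\<lambda>k. \<Prod>i<CARD('n) - k. X - of_nat CARD('a) ^ i"]
    gauss_binomial_cauchy[OF card_field_gt_1[where 'a = 'a], of "CARD('n) - vec.dim U" X]
  by simp

text \<open>Double counting with \<open>U = {0}\<close>, \<open>d = 0\<close> and
  \<open>N = 1\<close>: each nonzero vector lies on exactly one line. The resulting product equation
  shows that the division is exact.\<close>

lemma card_points:
  fixes W :: "('a::{field,finite} ^ 'n) set"
  assumes W: "vec.subspace W"
  shows "card {L. vec.subspace L \<and> vec.dim L = 1 \<and> L \<subseteq> W} =
    (CARD('a) ^ vec.dim W - 1) div (CARD('a) - 1)"
proof -
  let ?q = "CARD('a)" and ?P = "{L. vec.subspace L \<and> vec.dim L = 1 \<and> L \<subseteq> W}"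
  have P: "?P = intermediate_subspaces {0} W 1"
    unfolding intermediate_subspaces_def by (auto simp: vec.subspace_0)
  have "intermediate_subspaces (vec.span (insert v {0})) W 0 = {vec.span (insert v {0})}"
    if "v \<in> W - {0}" for v
  proof -
    have "vec.span (insert v {0}) \<subseteq> W"
      using that W by (intro vec.span_minimal) (auto simp: vec.subspace_0)
    then show ?thesis
      unfolding intermediate_subspaces_def
      using vec.subspace_dim_equal[of "vec.span (insert v {0})"] by fastforce
  qed
  then have eq: "card ?P * (?q - 1) = ?q ^ vec.dim W - 1"
    using card_intermediate_subspaces_step[of "{0}" W 0 1] W
    unfolding P by (simp add: vec.subspace_0)
  have "?q - 1 > 0"
    using card_field_gt_1[where 'a = 'a] by simp
  then show ?thesis
    unfolding eq[symmetric] by (rule div_mult_self_is_m[symmetric])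
qed

section \<open>The characteristic polynomial of the dual\<close>

lemma to_fract_power: "to_fract (x ^ k) = to_fract x ^ k"
  by (induction k) auto

lemma to_fract_monom:
  "to_fract (monom ((-1) ^ m) k :: int poly) = (-1) ^ m * to_fract [:0, 1:] ^ k"
proof -
  have "monom ((-1) ^ m) k = (-1) ^ m * [:0, 1 :: int:] ^ k"
    by (cases "even m") (simp_all add: monom_altdef)
  then show ?thesis
    by (simp add: to_fract_power)
qed

text \<open>The fraction field gives a meaning to division by a power of x. The sum is indexed by
  the complements \<open>B\<close> of the sets in the definition.\<close>

lemma characteristic_poly_dual:
  fixes X :: "int poly fract"
  assumes M: "is_matroid M" and X: "X = to_fract [:0, 1:]"
  shows "to_fract (characteristic_poly (dual M)) =
    (-1) ^ card (ground M) / X ^ rk M (ground M) *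
    (\<Sum>B\<in>Pow (ground M). (- X) ^ card B * X ^ (rk M (ground M) - rk M B))"
proof -
  let ?E = "ground M"
  have fin: "finite ?E" and le_card: "\<And>B. B \<subseteq> ?E \<Longrightarrow> rk M B \<le> card B"
    and mono: "\<And>B. B \<subseteq> ?E \<Longrightarrow> rk M B \<le> rk M ?E"
    using M unfolding is_matroid_def by auto
  have X0: "X \<noteq> 0"
    by (simp add: X)
  have term_eq: "(-1) ^ card (?E - B) * X ^ (rk (dual M) ?E - rk (dual M) (?E - B)) =
      (-1) ^ card ?E / X ^ rk M ?E * ((- X) ^ card B * X ^ (rk M ?E - rk M B))"
    if B: "B \<subseteq> ?E" for B
  proof -
    have finB: "finite B"
      using B fin by (rule finite_subset)
    have cB: "card B \<le> card ?E"
      using fin B by (rule card_mono)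
    have cd: "card (?E - B) = card ?E - card B"
      using finB B by (rule card_Diff_subset)
    have "rk M {} = 0"
      using le_card[of "{}"] by simp
    moreover have "?E - (?E - B) = B"
      using B by blast
    \<comment> \<open>By \<open>rk_dual\<close>, r*(E) = |E| - r(E) and r*(E - B) = r(B) + |E - B| -
      r(E).\<close>
    ultimately have exp: "rk (dual M) ?E - rk (dual M) (?E - B) = card B - rk M B"
      using rk_dual[OF M subset_refl] rk_dual[OF M Diff_subset, of B] le_card[OF B] mono[OF B] cB
      by (simp add: cd)
    have "X ^ (card B - rk M B) * X ^ rk M ?E = X ^ card B * X ^ (rk M ?E - rk M B)"
      using le_card[OF B] mono[OF B] by (simp flip: power_add)
    then have "X ^ (card B - rk M B) = X ^ card B * X ^ (rk M ?E - rk M B) / X ^ rk M ?E"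
      using X0 by (simp add: field_simps)
    moreover have "(-1 :: int poly fract) ^ (card ?E - card B) = (-1) ^ card ?E * (-1) ^ card B"
      using cB by (auto simp: minus_one_power_iff)
    moreover have "(- X) ^ card B = (-1) ^ card B * X ^ card B"
      by (rule power_minus)
    ultimately show ?thesis
      unfolding exp cd by simp
  qed
  have "to_fract (characteristic_poly (dual M)) =
      (\<Sum>A\<in>Pow ?E. (-1) ^ card A * X ^ (rk (dual M) ?E - rk (dual M) A))"
    unfolding characteristic_poly_def X by (simp add: to_fract_monom dual_def)
  also have "\<dots> =
      (\<Sum>B\<in>Pow ?E. (-1) ^ card (?E - B) * X ^ (rk (dual M) ?E - rk (dual M) (?E - B)))"
    by (rule sum.reindex_bij_witness[of _ "\<lambda>B. ?E - B" "\<lambda>B. ?E - B"]) (auto simp: double_diff)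
  also have "\<dots> = (\<Sum>B\<in>Pow ?E. (-1) ^ card ?E / X ^ rk M ?E *
      ((- X) ^ card B * X ^ (rk M ?E - rk M B)))"
    by (rule sum.cong) (auto simp: term_eq)
  finally show ?thesis
    by (simp add: sum_distrib_left)
qed

text \<open>Expanding a product of factors 1 + y over \<open>S\<close> gives one term for each
  subset, the elements where y is chosen.\<close>

lemma sum_Pow_power_card:
  fixes y :: "'b::comm_ring_1"
  assumes "finite S"
  shows "(\<Sum>B\<in>Pow S. y ^ card B) = (1 + y) ^ card S"
  using prod_add[OF assms, of "\<lambda>_. y" "\<lambda>_. 1"] by (simp add: add.commute)

text \<open>The vacuous condition \<open>L \<subseteq> UNIV\<close> gives the form of
  \<open>card_points\<close> for \<open>W = UNIV\<close>.\<close>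

lemma ground_PG: "ground (PG :: ('a::{field,finite} ^ 'n) set matroid) =
    {L. vec.subspace L \<and> vec.dim L = 1 \<and> L \<subseteq> UNIV}"
  by (simp add: PG_def)

lemma span_ground_PG:
  "vec.span (\<Union>(ground (PG :: ('a::{field,finite} ^ 'n) set matroid))) = UNIV"
proof -
  have "v \<in> vec.span (\<Union>(ground PG))" for v :: "'a ^ 'n"
  proof (cases "v = 0")
    case False
    then have "vec.span {v} \<in> ground PG"
      by (simp add: PG_def vec.dim_insert)
    then show ?thesis
      by (meson UnionI insertI1 vec.span_base)
  qed (simp add: vec.span_zero)
  then show ?thesis
    by blast
qed

theorem theorem4:
  fixes q n :: nat and X :: "int poly fract"
  assumes "q = CARD('a::{field,finite})" and "n = CARD('n::finite)"
    and "X = to_fract [:0, 1:]"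
  shows "to_fract (characteristic_poly (dual (PG :: ('a ^ 'n) set matroid))) =
    (-1) ^ ((q ^ n - 1) div (q - 1)) / X ^ n *
    (\<Sum>k=0..n. gauss_binomial q n k * (1 - X) ^ ((q ^ k - 1) div (q - 1)) *
       (\<Prod>i<n - k. X - of_nat q ^ i))"
proof -
  let ?M = "PG :: ('a ^ 'n) set matroid"
  let ?E = "ground ?M"
  let ?Sub = "{W :: ('a ^ 'n) set. vec.subspace W}"
  define p where "p k = (\<Prod>i<n - k. X - of_nat q ^ i)" for k
  define e where "e k = (q ^ k - 1) div (q - 1)" for k
  have cardE: "card ?E = e n"
    unfolding ground_PG by (subst card_points) (simp_all add: assms e_def vec_dim_card del: vec.dim_UNIV)
  have rk: "rk ?M B = vec.dim (vec.span (\<Union>B))" for B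
    by (simp add: PG_def)
  have rkE: "rk ?M ?E = n"
    unfolding rk span_ground_PG by (simp add: assms vec_dim_card del: vec.dim_UNIV)
  \<comment> \<open>The range is stated by \<open>\<Union>B \<subseteq> W\<close> rather than by the
    span, so that it can be read as a condition on \<open>B\<close> when the sums are
    exchanged.\<close>
  have pow: "X ^ (n - rk ?M B) = (\<Sum>W | W \<in> ?Sub \<and> \<Union>B \<subseteq> W. p (vec.dim W))" for B
  proof -
    have "vec.span (\<Union>B) \<subseteq> W \<longleftrightarrow> \<Union>B \<subseteq> W" if "vec.subspace W" for W
      using that by (meson order_trans vec.span_minimal vec.span_superset)
    then have "{W. vec.subspace W \<and> vec.span (\<Union>B) \<subseteq> W} = {W. W \<in> ?Sub \<and> \<Union>B \<subseteq> W}"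
      by blast
    then show ?thesis
      using power_codim_eq_sum_subspaces[of "vec.span (\<Union>B)" X]
      by (simp add: rk p_def assms)
  qed
  have sets: "(\<Sum>B | B \<in> Pow ?E \<and> \<Union>B \<subseteq> W. (- X) ^ card B) = (1 - X) ^ e (vec.dim W)"
    if "W \<in> ?Sub" for W
  proof -
    let ?P = "{L. vec.subspace L \<and> vec.dim L = 1 \<and> L \<subseteq> W}"
    \<comment> \<open>A union of points lies in \<open>W\<close> iff each of the points does, so
      \<open>B\<close> ranges over all sets of points of \<open>W\<close>.\<close>
    have "{B. B \<in> Pow ?E \<and> \<Union>B \<subseteq> W} = Pow ?P"
      by (auto simp: PG_def)
    moreover have "card ?P = e (vec.dim W)"
      using that by (subst card_points) (simp_all add: e_def assms)
    ultimately show ?thesis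
      using sum_Pow_power_card[of ?P "- X"] by (simp only: finite) simp
  qed
  have "(\<Sum>B\<in>Pow ?E. (- X) ^ card B * X ^ (n - rk ?M B)) =
      (\<Sum>B\<in>Pow ?E. \<Sum>W | W \<in> ?Sub \<and> \<Union>B \<subseteq> W. (- X) ^ card B * p (vec.dim W))"
    by (simp only: pow sum_distrib_left)
  also have "\<dots> = (\<Sum>W\<in>?Sub. \<Sum>B | B \<in> Pow ?E \<and> \<Union>B \<subseteq> W. (- X) ^ card B * p (vec.dim W))"
    by (rule sum.swap_restrict) auto
  also have "\<dots> = (\<Sum>W\<in>?Sub. (1 - X) ^ e (vec.dim W) * p (vec.dim W))"
    by (rule sum.cong) (simp_all only: sets sum_distrib_right[symmetric])
  \<comment> \<open>All subspaces contain 0, so \<open>sum_subspaces_containing\<close> applies with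
    \<open>U = {0}\<close>.\<close>
  also have "?Sub = {W. vec.subspace W \<and> {0} \<subseteq> W}"
    by (auto simp: vec.subspace_0)
  also have "(\<Sum>W\<in>\<dots>. (1 - X) ^ e (vec.dim W) * p (vec.dim W)) =
      (\<Sum>k\<le>n. gauss_binomial q n k * ((1 - X) ^ e k * p k))"
    using sum_subspaces_containing[of "{0} :: ('a ^ 'n) set" "\<lambda>k. (1 - X) ^ e k * p k"]
    by (simp add: assms)
  finally have "(\<Sum>B\<in>Pow ?E. (- X) ^ card B * X ^ (n - rk ?M B)) =
      (\<Sum>k=0..n. gauss_binomial q n k * (1 - X) ^ e k * p k)"
    by (simp add: atLeast0AtMost mult.assoc)
  then show ?thesis
    unfolding characteristic_poly_dual[OF is_matroid_PG assms(3)] rkE cardE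
    by (simp add: e_def p_def)
qed

end
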